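(* Let $C_1,\dots,C_n$ be independent first class constraints on $\mathcal{M}$, let $T_1,\dots,T_n\in C^\infty(\mathcal{M})$ be clock variables such that the matrix $A_{jk}:=\{C_j,T_k\}$ is invertible with smooth entries $A^{-1}_{jk}$ of the inverse, and let $f\in C^\infty(\mathcal{M})$. Define $S_j:C^\infty(\mathcal{M})\to C^\infty(\mathcal{M})$ by $S_j(h):=\sum_{l=1}^nA^{-1}_{jl}\{C_l,h\}$. Consider the series $$\sum_{k_1,\dots,k_n=0}^\infty\frac{1}{k_1!\cdots k_n!}\,\big(S_1^{k_1}\circ\cdots\circ S_n^{k_n}(f)\big)(y)\,(\tau_1-T_1(y))^{k_1}\cdots(\tau_n-T_n(y))^{k_n},$$ which, for $y$ a point on the gauge orbit $\mathcal{G}_x$ through $x$, is the formal power series in $\tau$ around $\tau_i=T_i(y)$ of the complete observable $F_{[f,T_i]}(\tau,x)$. Assume that for fixed values $\tau_i=\tau_{0i}$ of the parameters the series converges in some neighbourhood of a phase space point $x_0$, and that differentiation with respect to the phase space variables and summation can be permuted. Then the sum of the series, as a function of the phase space point, weakly Poisson commutes with the constraints: its Poisson bracket with each $C_k$, $k=1,\dots,n$, vanishes on the constraint hypersurface $\mathcal{C}$ (within that neighbourhood). Hence, under these convergence conditions, the series provides a local definition of a complete observable.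
   Context: $\mathcal{M}$ is a $2p$-dimensional smooth manifold with a non-degenerate Poisson bracket $\{\cdot,\cdot\}$. The constraints are smooth functions $C_1,\dots,C_n$ ($n<p$), independent in the sense that the constraint hypersurface $\mathcal{C}=\{C_1=\dots=C_n=0\}$ is $(2p-n)$-dimensional; first class means $\{C_i,C_j\}=\sum_kf_{ijk}C_k$ with $f_{ijk}$ smooth functions. The gauge orbit $\mathcal{G}_x$ is the set of points reached from $x$ by compositions of the Hamiltonian flows generated by the constraints. The complete observable $F_{[f,T_i]}(\tau,x)$ is the value of $f$ at the point of $\mathcal{G}_x$ at which $T_i=\tau_i$ for $i=1,\dots,n$; more generally, a complete observable is a phase space function that (weakly) Poisson commutes with the constraints. "Weakly" means on $\mathcal{C}$. *)

theory Defs
  imports "HOL-Analysis.Analysis"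
begin

section \<open>Smooth functions on open subsets of Euclidean spaces\<close>

text \<open>Only meant for open \<open>S\<close>, since the derivatives are taken at \<open>x\<close>, not within \<open>S\<close>.\<close>

primrec Ck_on ::
  "nat \<Rightarrow> 'e::euclidean_space set \<Rightarrow> ('e \<Rightarrow> 'b::real_normed_vector) \<Rightarrow> bool"
  where
    "Ck_on 0 S f \<longleftrightarrow> continuous_on S f"
  | "Ck_on (Suc k) S f \<longleftrightarrow>
      (\<forall>x\<in>S. f differentiable (at x)) \<and>
      (\<forall>v. Ck_on k S (\<lambda>x. frechet_derivative f (at x) v))"

definition smooth_on :: "'e::euclidean_space set \<Rightarrow> ('e \<Rightarrow> 'b::real_normed_vector) \<Rightarrow> bool"
  where "smooth_on S f \<longleftrightarrow> (\<forall>k. Ck_on k S f)"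


section \<open>Smooth manifolds\<close>

text \<open>
  The manifold is a whole (Hausdorff, second countable) topological type \<open>'a\<close>; its dimension is
  the dimension of the model space \<open>'e\<close>. A chart is a pair of a domain and a coordinate map; the
  values of the coordinate map outside the domain are irrelevant.
\<close>

type_synonym ('a, 'e) chart = "'a set \<times> ('a \<Rightarrow> 'e)"

abbreviation dom_of :: "('a, 'e) chart \<Rightarrow> 'a set" where "dom_of c \<equiv> fst c"
abbreviation coord :: "('a, 'e) chart \<Rightarrow> 'a \<Rightarrow> 'e" where "coord c \<equiv> snd c"

definition inv_coord :: "('a, 'e) chart \<Rightarrow> 'e \<Rightarrow> 'a"
  where "inv_coord c = inv_into (dom_of c) (coord c)"

definition is_chart :: "('a::topological_space, 'e::euclidean_space) chart \<Rightarrow> bool"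
  where "is_chart c \<longleftrightarrow> open (dom_of c) \<and> open (coord c ` dom_of c) \<and>
    homeomorphism (dom_of c) (coord c ` dom_of c) (coord c) (inv_coord c)"

definition smoothly_compatible ::
  "('a::topological_space, 'e::euclidean_space) chart \<Rightarrow> ('a, 'e) chart \<Rightarrow> bool"
  where "smoothly_compatible c d \<longleftrightarrow>
    smooth_on (coord c ` (dom_of c \<inter> dom_of d)) (coord d \<circ> inv_coord c) \<and>
    smooth_on (coord d ` (dom_of c \<inter> dom_of d)) (coord c \<circ> inv_coord d)"

definition smooth_atlas ::
  "('a::{t2_space, second_countable_topology}, 'e::euclidean_space) chart set \<Rightarrow> bool"
  where "smooth_atlas \<A> \<longleftrightarrow>
    (\<forall>c\<in>\<A>. is_chart c) \<and> (\<Union>c\<in>\<A>. dom_of c) = UNIV \<and>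
    (\<forall>c\<in>\<A>. \<forall>d\<in>\<A>. smoothly_compatible c d)"

definition smooth_fun ::
  "('a::topological_space, 'e::euclidean_space) chart set \<Rightarrow> ('a \<Rightarrow> real) \<Rightarrow> bool"
  where "smooth_fun \<A> f \<longleftrightarrow> (\<forall>c\<in>\<A>. smooth_on (coord c ` dom_of c) (f \<circ> inv_coord c))"

definition differentiable_at ::
  "('a::topological_space, 'e::euclidean_space) chart set \<Rightarrow> ('a \<Rightarrow> real) \<Rightarrow> 'a \<Rightarrow> bool"
  where "differentiable_at \<A> f x \<longleftrightarrow>
    (\<forall>c\<in>\<A>. x \<in> dom_of c \<longrightarrow> (f \<circ> inv_coord c) differentiable (at (coord c x)))"

text \<open>The partial derivative of \<open>f\<close> at \<open>x\<close> along the \<open>b\<close>-th coordinate (\<open>b \<in> Basis\<close>) of \<open>c\<close>.\<close>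

definition partial ::
  "('a::topological_space, 'e::euclidean_space) chart \<Rightarrow> 'e \<Rightarrow> ('a \<Rightarrow> real) \<Rightarrow> 'a \<Rightarrow> real"
  where "partial c b f x = frechet_derivative (f \<circ> inv_coord c) (at (coord c x)) b"

text \<open>
  Embedded submanifolds of dimension \<open>k\<close>, through slice charts; these range over all charts
  compatible with the atlas, i.e. over the maximal atlas.
\<close>

definition submanifold ::
  "('a::topological_space, 'e::euclidean_space) chart set \<Rightarrow> nat \<Rightarrow> 'a set \<Rightarrow> bool"
  where "submanifold \<A> k S \<longleftrightarrow>
    (\<forall>x\<in>S. \<exists>d L. is_chart d \<and> (\<forall>c\<in>\<A>. smoothly_compatible c d) \<and> x \<in> dom_of d \<and>
      subspace L \<and> dim L = k \<and> coord d ` (dom_of d \<inter> S) = coord d ` dom_of d \<inter> L)"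


section \<open>Poisson brackets\<close>

text \<open>
  A Poisson bracket is a Lie bracket on the smooth functions that is a derivation in each argument.
  As such it depends only on the first derivatives of its arguments at the given point, and
  this is how \<open>{f, g}(x)\<close> is understood when \<open>f\<close> and \<open>g\<close> are merely differentiable at \<open>x\<close>
  (for instance, when they are sums of series defined only near \<open>x\<close>). The last clause
  records this convention: in local coordinates \<open>x\<^sup>a\<close>, the bracket is
  \<open>\<Sum>a b. P\<^sup>a\<^sup>b \<partial>\<^sub>a f \<partial>\<^sub>b g\<close>. For smooth \<open>f\<close> and \<open>g\<close> it follows from the other clauses, which
  also make \<open>P\<close> unique, smooth and skew.
\<close>

definition poisson_bracket ::
  "('a::topological_space, 'e::euclidean_space) chart set \<Rightarrow>
    (('a \<Rightarrow> real) \<Rightarrow> ('a \<Rightarrow> real) \<Rightarrow> ('a \<Rightarrow> real)) \<Rightarrow> bool"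
  where "poisson_bracket \<A> pb \<longleftrightarrow>
    (\<forall>f g. smooth_fun \<A> f \<longrightarrow> smooth_fun \<A> g \<longrightarrow>
       smooth_fun \<A> (pb f g) \<and> (\<forall>x. pb f g x = - pb g f x)) \<and>
    (\<forall>f g h. smooth_fun \<A> f \<longrightarrow> smooth_fun \<A> g \<longrightarrow> smooth_fun \<A> h \<longrightarrow>
       (\<forall>r s x. pb f (\<lambda>y. r * g y + s * h y) x = r * pb f g x + s * pb f h x) \<and>
       (\<forall>x. pb f (\<lambda>y. g y * h y) x = pb f g x * h x + g x * pb f h x) \<and>
       (\<forall>x. pb f (pb g h) x + pb g (pb h f) x + pb h (pb f g) x = 0)) \<and>
    (\<forall>c\<in>\<A>. \<exists>P :: 'a \<Rightarrow> 'e \<Rightarrow> 'e \<Rightarrow> real. \<forall>x\<in>dom_of c. \<forall>f g.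
       differentiable_at \<A> f x \<longrightarrow> differentiable_at \<A> g x \<longrightarrow>
       pb f g x = (\<Sum>a\<in>Basis. \<Sum>b\<in>Basis. P x a b * partial c a f x * partial c b g x))"

text \<open>Non-degeneracy: only the zero covector \<open>df(x)\<close> is annihilated by the bracket at \<open>x\<close>.\<close>

definition nondegenerate ::
  "('a::topological_space, 'e::euclidean_space) chart set \<Rightarrow>
    (('a \<Rightarrow> real) \<Rightarrow> ('a \<Rightarrow> real) \<Rightarrow> ('a \<Rightarrow> real)) \<Rightarrow> bool"
  where "nondegenerate \<A> pb \<longleftrightarrow>
    (\<forall>f x. smooth_fun \<A> f \<longrightarrow> (\<forall>g. smooth_fun \<A> g \<longrightarrow> pb f g x = 0) \<longrightarrow>
       (\<forall>c\<in>\<A>. x \<in> dom_of c \<longrightarrow> (\<forall>b\<in>Basis. partial c b f x = 0)))"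


section \<open>Constraints and complete observables\<close>

definition constraint_surface :: "nat \<Rightarrow> (nat \<Rightarrow> 'a \<Rightarrow> real) \<Rightarrow> 'a set"
  where "constraint_surface n C = {x. \<forall>i\<in>{1..n}. C i x = 0}"

definition first_class ::
  "('a::topological_space, 'e::euclidean_space) chart set \<Rightarrow>
    (('a \<Rightarrow> real) \<Rightarrow> ('a \<Rightarrow> real) \<Rightarrow> ('a \<Rightarrow> real)) \<Rightarrow> nat \<Rightarrow> (nat \<Rightarrow> 'a \<Rightarrow> real) \<Rightarrow> bool"
  where "first_class \<A> pb n C \<longleftrightarrow>
    (\<exists>F. (\<forall>i\<in>{1..n}. \<forall>j\<in>{1..n}. \<forall>k\<in>{1..n}. smooth_fun \<A> (F i j k)) \<and>
      (\<forall>i\<in>{1..n}. \<forall>j\<in>{1..n}. \<forall>x. pb (C i) (C j) x = (\<Sum>k=1..n. F i j k x * C k x)))"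

text \<open>A complete observable on an open set \<open>U\<close>: it weakly Poisson commutes with the constraints.\<close>

definition complete_observable_on ::
  "('a::topological_space, 'e::euclidean_space) chart set \<Rightarrow>
    (('a \<Rightarrow> real) \<Rightarrow> ('a \<Rightarrow> real) \<Rightarrow> ('a \<Rightarrow> real)) \<Rightarrow> nat \<Rightarrow> (nat \<Rightarrow> 'a \<Rightarrow> real) \<Rightarrow>
    'a set \<Rightarrow> ('a \<Rightarrow> real) \<Rightarrow> bool"
  where "complete_observable_on \<A> pb n C U F \<longleftrightarrow>
    (\<forall>y\<in>U. differentiable_at \<A> F y) \<and>
    (\<forall>k\<in>{1..n}. \<forall>y\<in>U \<inter> constraint_surface n C. pb F (C k) y = 0)"

definition inverse_matrix :: "nat \<Rightarrow> (nat \<Rightarrow> nat \<Rightarrow> real) \<Rightarrow> (nat \<Rightarrow> nat \<Rightarrow> real) \<Rightarrow> bool"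
  where "inverse_matrix n A B \<longleftrightarrow>
    (\<forall>i\<in>{1..n}. \<forall>j\<in>{1..n}.
      (\<Sum>l=1..n. A i l * B l j) = (if i = j then 1 else 0) \<and>
      (\<Sum>l=1..n. B i l * A l j) = (if i = j then 1 else 0))"

definition S_op ::
  "(('a \<Rightarrow> real) \<Rightarrow> ('a \<Rightarrow> real) \<Rightarrow> ('a \<Rightarrow> real)) \<Rightarrow> nat \<Rightarrow> (nat \<Rightarrow> 'a \<Rightarrow> real) \<Rightarrow>
    (nat \<Rightarrow> nat \<Rightarrow> 'a \<Rightarrow> real) \<Rightarrow> nat \<Rightarrow> ('a \<Rightarrow> real) \<Rightarrow> ('a \<Rightarrow> real)"
  where "S_op pb n C Ainv j h = (\<lambda>y. \<Sum>l=1..n. Ainv j l y * pb (C l) h y)"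

text \<open>\<open>S_1\<^sup>k\<^sup>1 \<circ> \<dots> \<circ> S_n\<^sup>k\<^sup>n\<close>; the powers of \<open>S_n\<close> act first.\<close>

definition S_iter ::
  "(('a \<Rightarrow> real) \<Rightarrow> ('a \<Rightarrow> real) \<Rightarrow> ('a \<Rightarrow> real)) \<Rightarrow> nat \<Rightarrow> (nat \<Rightarrow> 'a \<Rightarrow> real) \<Rightarrow>
    (nat \<Rightarrow> nat \<Rightarrow> 'a \<Rightarrow> real) \<Rightarrow> (nat \<Rightarrow> nat) \<Rightarrow> ('a \<Rightarrow> real) \<Rightarrow> ('a \<Rightarrow> real)"
  where "S_iter pb n C Ainv k f = foldr (\<lambda>j. S_op pb n C Ainv j ^^ k j) [1..<Suc n] f"

definition multi_indices :: "nat \<Rightarrow> (nat \<Rightarrow> nat) set"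
  where "multi_indices n = ({1..n} \<rightarrow>\<^sub>E UNIV)"

definition series_term ::
  "(('a \<Rightarrow> real) \<Rightarrow> ('a \<Rightarrow> real) \<Rightarrow> ('a \<Rightarrow> real)) \<Rightarrow> nat \<Rightarrow> (nat \<Rightarrow> 'a \<Rightarrow> real) \<Rightarrow>
    (nat \<Rightarrow> nat \<Rightarrow> 'a \<Rightarrow> real) \<Rightarrow> (nat \<Rightarrow> 'a \<Rightarrow> real) \<Rightarrow> ('a \<Rightarrow> real) \<Rightarrow> (nat \<Rightarrow> real) \<Rightarrow>
    (nat \<Rightarrow> nat) \<Rightarrow> 'a \<Rightarrow> real"
  where "series_term pb n C Ainv T f \<tau> k y =
    1 / (\<Prod>i=1..n. fact (k i)) * S_iter pb n C Ainv k f y * (\<Prod>i=1..n. (\<tau> i - T i y) ^ k i)"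

definition series_sum ::
  "(('a \<Rightarrow> real) \<Rightarrow> ('a \<Rightarrow> real) \<Rightarrow> ('a \<Rightarrow> real)) \<Rightarrow> nat \<Rightarrow> (nat \<Rightarrow> 'a \<Rightarrow> real) \<Rightarrow>
    (nat \<Rightarrow> nat \<Rightarrow> 'a \<Rightarrow> real) \<Rightarrow> (nat \<Rightarrow> 'a \<Rightarrow> real) \<Rightarrow> ('a \<Rightarrow> real) \<Rightarrow> (nat \<Rightarrow> real) \<Rightarrow>
    'a \<Rightarrow> real"
  where "series_sum pb n C Ainv T f \<tau> y =
    (\<Sum>\<^sub>\<infinity>k\<in>multi_indices n. series_term pb n C Ainv T f \<tau> k y)"

text \<open>Differentiation with respect to the phase space variables and summation can be permuted.\<close>

definition termwise_differentiable_on ::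
  "('a::topological_space, 'e::euclidean_space) chart set \<Rightarrow> 'a set \<Rightarrow> 'i set \<Rightarrow>
    ('i \<Rightarrow> 'a \<Rightarrow> real) \<Rightarrow> ('a \<Rightarrow> real) \<Rightarrow> bool"
  where "termwise_differentiable_on \<A> U I t F \<longleftrightarrow>
    (\<forall>y\<in>U. differentiable_at \<A> F y \<and>
      (\<forall>c\<in>\<A>. y \<in> dom_of c \<longrightarrow>
        (\<forall>b\<in>Basis. ((\<lambda>k. partial c b (t k) y) has_sum partial c b F y) I)))"

end

theory Submission
  imports Defs
begin

text \<open>
  Modulo the ideal generated by the constraints, the derivations \<open>S\<^sub>j\<close> commute: each \<open>S\<^sub>j\<close> preserves
  the ideal, and \<open>[S\<^sub>i, S\<^sub>j]\<close> is a combination of the \<open>{C\<^sub>m, -}\<close>, whose coefficients lie in the ideal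
  because \<open>[S\<^sub>i, S\<^sub>j]\<close> annihilates the clocks (\<open>S\<^sub>j T\<^sub>k = \<delta>\<^sub>j\<^sub>k\<close>) and \<open>A\<close> is invertible. On the constraint
  hypersurface, \<open>S\<^sub>j\<close> therefore sends the \<open>k\<close>-th term of the series to \<open>a (k + e\<^sub>j) - a k\<close>, where
  \<open>a k\<close> is the \<open>k\<close>-th term of the formal \<open>\<tau>\<^sub>j\<close>-derivative of the series. Along each line in direction \<open>e\<^sub>j\<close> this telescopes to
  the limit of \<open>a\<close>, and convergence of the original series forces that limit to be zero. So
  \<open>S\<^sub>j\<close> applied termwise gives zero for every \<open>j\<close>, and inverting the matrix \<open>A\<inverse>\<close> gives the claim for every \<open>C\<^sub>k\<close>.
\<close>

section \<open>Functions of class \<open>C^k\<close> on open sets\<close>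

text \<open>The derivatives are taken at interior points, so openness of \<open>S\<close> lets
  agreement on \<open>S\<close> carry over to them. This is how the derivative formulas for sums and
  products, valid only on \<open>S\<close>, enter the inductions below.\<close>

lemma Ck_on_cong:
  assumes "open S" "\<And>x. x \<in> S \<Longrightarrow> f x = g x" "Ck_on k S f"
  shows "Ck_on k S g"
  using assms(2,3)
proof (induction k arbitrary: f g)
  case 0
  then show ?case by (simp cong: continuous_on_cong)
next
  case (Suc k)
  have diff: "f differentiable (at x)" if "x \<in> S" for x
    using Suc.prems(2) that by simp
  have "g differentiable (at x)" if "x \<in> S" for x
    using diff[OF that] Suc.prems(1) that \<open>open S\<close>
    unfolding differentiable_def by (metis has_derivative_transform_within_open)
  moreover have "Ck_on k S (\<lambda>x. frechet_derivative g (at x) v)" for v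
  proof (rule Suc.IH)
    show "Ck_on k S (\<lambda>x. frechet_derivative f (at x) v)"
      using Suc.prems(2) by simp
    show "frechet_derivative f (at x) v = frechet_derivative g (at x) v" if "x \<in> S" for x
      using frechet_derivative_transform_within_open[OF diff[OF that] \<open>open S\<close> that Suc.prems(1)]
      by simp
  qed
  ultimately show ?case by simp
qed

lemma Ck_on_Suc_imp_Ck_on:
  assumes "Ck_on (Suc k) S f"
  shows "Ck_on k S f"
  using assms
proof (induction k arbitrary: f)
  case 0
  then show ?case
    by (auto intro!: continuous_at_imp_continuous_on differentiable_imp_continuous_within)
next
  case (Suc k)
  then show ?case using Ck_on.simps(2) by blast
qed

lemma Ck_on_const: "Ck_on k S (\<lambda>x. c)"
  by (induction k arbitrary: c) auto

lemma Ck_on_add: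
  assumes "open S" "Ck_on k S f" "Ck_on k S g"
  shows "Ck_on k S (\<lambda>x. f x + g x)"
  using assms(2,3)
proof (induction k arbitrary: f g)
  case 0
  then show ?case by (auto intro: continuous_on_add)
next
  case (Suc k)
  have "Ck_on k S (\<lambda>x. frechet_derivative (\<lambda>x. f x + g x) (at x) v)" for v
  proof (rule Ck_on_cong[OF \<open>open S\<close>])
    show "Ck_on k S (\<lambda>x. frechet_derivative f (at x) v + frechet_derivative g (at x) v)"
      using Suc by simp
    show "frechet_derivative f (at x) v + frechet_derivative g (at x) v =
        frechet_derivative (\<lambda>x. f x + g x) (at x) v" if "x \<in> S" for x
    proof -
      have "f differentiable (at x)" "g differentiable (at x)"
        using Suc.prems that by auto
      then have "((\<lambda>x. f x + g x) has_derivative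
          (\<lambda>v. frechet_derivative f (at x) v + frechet_derivative g (at x) v)) (at x)"
        by (intro has_derivative_add) (simp_all add: frechet_derivative_works[symmetric])
      from frechet_derivative_at[OF this] show ?thesis by (rule fun_cong)
    qed
  qed
  with Suc.prems show ?case by simp
qed

lemma Ck_on_mult:
  fixes f g :: "'e::euclidean_space \<Rightarrow> real"
  assumes "open S" "Ck_on k S f" "Ck_on k S g"
  shows "Ck_on k S (\<lambda>x. f x * g x)"
  using assms(2,3)
proof (induction k arbitrary: f g)
  case 0
  then show ?case by (auto intro: continuous_on_mult)
next
  case (Suc k)
  have "Ck_on k S (\<lambda>x. frechet_derivative (\<lambda>x. f x * g x) (at x) v)" for v
  proof (rule Ck_on_cong[OF \<open>open S\<close>])
    \<comment> \<open>The product rule leaves one factor undifferentiated; its class has to be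
      lowered to \<open>k\<close> before the induction hypothesis applies.\<close>
    have "Ck_on k S f" "Ck_on k S g"
      using Suc.prems by (auto intro: Ck_on_Suc_imp_Ck_on simp del: Ck_on.simps)
    then show "Ck_on k S (\<lambda>x. f x * frechet_derivative g (at x) v + frechet_derivative f (at x) v * g x)"
      using Suc by (intro Ck_on_add[OF \<open>open S\<close>]) auto
    show "f x * frechet_derivative g (at x) v + frechet_derivative f (at x) v * g x =
        frechet_derivative (\<lambda>x. f x * g x) (at x) v" if "x \<in> S" for x
    proof -
      have "f differentiable (at x)" "g differentiable (at x)"
        using Suc.prems that by auto
      then have "((\<lambda>x. f x * g x) has_derivative
          (\<lambda>v. f x * frechet_derivative g (at x) v + frechet_derivative f (at x) v * g x)) (at x)"
        by (intro has_derivative_mult) (simp_all add: frechet_derivative_works[symmetric])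
      from frechet_derivative_at[OF this] show ?thesis by (rule fun_cong)
    qed
  qed
  with Suc.prems show ?case by simp
qed

section \<open>Smooth functions on the manifold\<close>

lemma open_chart_image:
  assumes "smooth_atlas \<A>" "c \<in> \<A>"
  shows "open (coord c ` dom_of c)"
  using assms by (simp add: smooth_atlas_def is_chart_def)

lemma smooth_fun_const: "smooth_fun \<A> (\<lambda>x. r)"
  by (simp add: smooth_fun_def smooth_on_def o_def Ck_on_const)

lemma smooth_fun_add:
  assumes "smooth_atlas \<A>" "smooth_fun \<A> f" "smooth_fun \<A> g"
  shows "smooth_fun \<A> (\<lambda>x. f x + g x)"
  using assms open_chart_image[OF assms(1)]
  by (simp add: smooth_fun_def smooth_on_def o_def Ck_on_add)

lemma smooth_fun_mult:
  assumes "smooth_atlas \<A>" "smooth_fun \<A> f" "smooth_fun \<A> g"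
  shows "smooth_fun \<A> (\<lambda>x. f x * g x)"
  using assms open_chart_image[OF assms(1)]
  by (simp add: smooth_fun_def smooth_on_def o_def Ck_on_mult)

lemma smooth_fun_imp_differentiable_at:
  assumes "smooth_fun \<A> f"
  shows "differentiable_at \<A> f x"
  unfolding differentiable_at_def
proof (intro ballI impI)
  fix c assume "c \<in> \<A>" "x \<in> dom_of c"
  then have "Ck_on (Suc 0) (coord c ` dom_of c) (f \<circ> inv_coord c)"
    using assms unfolding smooth_fun_def smooth_on_def by blast
  then show "(f \<circ> inv_coord c) differentiable (at (coord c x))"
    using \<open>x \<in> dom_of c\<close> by auto
qed

section \<open>Termwise brackets of a series\<close>

lemma has_sum_finite_sum:
  fixes f :: "'i \<Rightarrow> 'k \<Rightarrow> 'b::topological_comm_monoid_add"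
  assumes "\<And>i. i \<in> J \<Longrightarrow> (f i has_sum s i) I"
  shows "((\<lambda>k. \<Sum>i\<in>J. f i k) has_sum (\<Sum>i\<in>J. s i)) I"
  using assms by (induction J rule: infinite_finite_induct) (simp_all add: has_sum_add)

text \<open>In a chart around \<open>y\<close> the bracket with a fixed \<open>g\<close> is a finite
  linear combination of the partial derivatives of the other argument. The coordinate form is used
  because \<open>F\<close> is only known to be differentiable, so the algebraic laws for smooth
  functions do not cover it.\<close>

lemma pb_has_sum:
  assumes atlas: "smooth_atlas \<A>" and bracket: "poisson_bracket \<A> pb"
    and g: "differentiable_at \<A> g y"
    and t: "\<And>k. k \<in> I \<Longrightarrow> differentiable_at \<A> (t k) y"
    and termwise: "termwise_differentiable_on \<A> U I t F" and y: "y \<in> U"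
  shows "((\<lambda>k. pb (t k) g y) has_sum pb F g y) I"
proof -
  obtain c where c: "c \<in> \<A>" "y \<in> dom_of c"
    using atlas unfolding smooth_atlas_def by blast
  have F: "differentiable_at \<A> F y"
    and partials: "\<And>b. b \<in> Basis \<Longrightarrow> ((\<lambda>k. partial c b (t k) y) has_sum partial c b F y) I"
    using termwise y c unfolding termwise_differentiable_on_def by blast+
  from bracket c(1) obtain P :: "'a \<Rightarrow> 'b \<Rightarrow> 'b \<Rightarrow> real" where
    "\<forall>x\<in>dom_of c. \<forall>f g. differentiable_at \<A> f x \<longrightarrow> differentiable_at \<A> g x \<longrightarrow>
       pb f g x = (\<Sum>a\<in>Basis. \<Sum>b\<in>Basis. P x a b * partial c a f x * partial c b g x)"
    unfolding poisson_bracket_def by blast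
  with c(2) g have P: "pb h g y = (\<Sum>a\<in>Basis. \<Sum>b\<in>Basis. P y a b * partial c a h y * partial c b g y)"
    if "differentiable_at \<A> h y" for h
    using that by blast
  have "((\<lambda>k. \<Sum>a\<in>Basis. \<Sum>b\<in>Basis. P y a b * partial c a (t k) y * partial c b g y) has_sum pb F g y) I"
    unfolding P[OF F]
    by (intro has_sum_finite_sum has_sum_cmult_left has_sum_cmult_right partials)
  then show ?thesis
    by (rule has_sum_cong[THEN iffD1, rotated]) (simp add: P t)
qed

section \<open>Poisson algebras and their derivations\<close>

text \<open>\<open>R\<close> abstracts the smooth functions. The laws are restricted to
  \<open>R\<close> because \<open>pb\<close> is a total function that they do not govern
  elsewhere.\<close>

locale poisson_algebra =
  fixes R :: "('a \<Rightarrow> real) set" and pb :: "('a \<Rightarrow> real) \<Rightarrow> ('a \<Rightarrow> real) \<Rightarrow> ('a \<Rightarrow> real)"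
  assumes const_mem: "(\<lambda>_. r) \<in> R"
    and add_mem: "\<lbrakk>g \<in> R; h \<in> R\<rbrakk> \<Longrightarrow> (\<lambda>x. g x + h x) \<in> R"
    and mult_mem: "\<lbrakk>g \<in> R; h \<in> R\<rbrakk> \<Longrightarrow> (\<lambda>x. g x * h x) \<in> R"
    and pb_mem: "\<lbrakk>g \<in> R; h \<in> R\<rbrakk> \<Longrightarrow> pb g h \<in> R"
    and pb_skew: "\<lbrakk>g \<in> R; h \<in> R\<rbrakk> \<Longrightarrow> pb g h x = - pb h g x"
    and pb_linear: "\<lbrakk>u \<in> R; g \<in> R; h \<in> R\<rbrakk> \<Longrightarrow>
      pb u (\<lambda>y. r * g y + s * h y) x = r * pb u g x + s * pb u h x"
    and pb_leibniz: "\<lbrakk>u \<in> R; g \<in> R; h \<in> R\<rbrakk> \<Longrightarrow>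
      pb u (\<lambda>y. g y * h y) x = pb u g x * h x + g x * pb u h x"
    and jacobi: "\<lbrakk>u \<in> R; g \<in> R; h \<in> R\<rbrakk> \<Longrightarrow>
      pb u (pb g h) x + pb g (pb h u) x + pb h (pb u g) x = 0"
begin

lemma uminus_mem: "g \<in> R \<Longrightarrow> (\<lambda>x. - g x) \<in> R"
  using mult_mem[OF const_mem[of "-1"], of g] by simp

lemma diff_mem: "\<lbrakk>g \<in> R; h \<in> R\<rbrakk> \<Longrightarrow> (\<lambda>x. g x - h x) \<in> R"
  using add_mem[OF _ uminus_mem, of g h] by simp

lemma sum_mem: "(\<And>i. i \<in> I \<Longrightarrow> g i \<in> R) \<Longrightarrow> (\<lambda>x. \<Sum>i\<in>I. g i x) \<in> R"
  by (induction I rule: infinite_finite_induct) (simp_all add: const_mem add_mem)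

lemma prod_mem: "(\<And>i. i \<in> I \<Longrightarrow> g i \<in> R) \<Longrightarrow> (\<lambda>x. \<Prod>i\<in>I. g i x) \<in> R"
  by (induction I rule: infinite_finite_induct) (simp_all add: const_mem mult_mem)

lemma power_mem: "g \<in> R \<Longrightarrow> (\<lambda>x. g x ^ m) \<in> R"
  by (induction m) (simp_all add: const_mem mult_mem)

definition derivation :: "(('a \<Rightarrow> real) \<Rightarrow> ('a \<Rightarrow> real)) \<Rightarrow> bool" where
  "derivation D \<longleftrightarrow> (\<forall>g\<in>R. D g \<in> R) \<and>
    (\<forall>g\<in>R. \<forall>h\<in>R. \<forall>r s x. D (\<lambda>y. r * g y + s * h y) x = r * D g x + s * D h x) \<and>
    (\<forall>g\<in>R. \<forall>h\<in>R. \<forall>x. D (\<lambda>y. g y * h y) x = D g x * h x + g x * D h x)"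

lemma derivation_pb: "u \<in> R \<Longrightarrow> derivation (pb u)"
  by (simp add: derivation_def pb_mem pb_linear pb_leibniz)

context
  fixes D assumes D: "derivation D"
begin

lemma derivation_mem: "g \<in> R \<Longrightarrow> D g \<in> R"
  using D by (simp add: derivation_def)

lemma derivation_mult:
  "\<lbrakk>g \<in> R; h \<in> R\<rbrakk> \<Longrightarrow> D (\<lambda>y. g y * h y) x = D g x * h x + g x * D h x"
  using D by (simp add: derivation_def)

lemma derivation_linear:
  "\<lbrakk>g \<in> R; h \<in> R\<rbrakk> \<Longrightarrow> D (\<lambda>y. r * g y + s * h y) x = r * D g x + s * D h x"
  using D unfolding derivation_def by blast

lemma derivation_add: "\<lbrakk>g \<in> R; h \<in> R\<rbrakk> \<Longrightarrow> D (\<lambda>y. g y + h y) x = D g x + D h x"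
  using derivation_linear[of g h 1 1 x] by simp

lemma derivation_diff: "\<lbrakk>g \<in> R; h \<in> R\<rbrakk> \<Longrightarrow> D (\<lambda>y. g y - h y) x = D g x - D h x"
  using derivation_linear[of g h 1 "-1" x] by simp

lemma derivation_cmult: "g \<in> R \<Longrightarrow> D (\<lambda>y. r * g y) x = r * D g x"
  using derivation_linear[of g g r 0 x] by simp

text \<open>The product rule for 1 * 1 forces the derivative of 1 to vanish; scaling gives the other
  constants.\<close>

lemma derivation_const: "D (\<lambda>_. r) x = 0"
  using derivation_mult[OF const_mem[of 1] const_mem[of 1], of x]
    derivation_cmult[OF const_mem[of 1], of r x] by simp

lemma derivation_uminus: "g \<in> R \<Longrightarrow> D (\<lambda>y. - g y) x = - D g x"
  using derivation_cmult[of g "-1" x] by simp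

lemma derivation_sum:
  "(\<And>i. i \<in> I \<Longrightarrow> g i \<in> R) \<Longrightarrow> D (\<lambda>y. \<Sum>i\<in>I. g i y) x = (\<Sum>i\<in>I. D (g i) x)"
  by (induction I rule: infinite_finite_induct)
    (simp_all add: derivation_const derivation_add sum_mem)

lemma derivation_prod_eq_0:
  "(\<And>i. i \<in> I \<Longrightarrow> g i \<in> R \<and> D (g i) x = 0) \<Longrightarrow> D (\<lambda>y. \<Prod>i\<in>I. g i y) x = 0"
  by (induction I rule: infinite_finite_induct)
    (simp_all add: derivation_const derivation_mult prod_mem)

lemma derivation_power:
  "g \<in> R \<Longrightarrow> D (\<lambda>y. g y ^ m) x = real m * g x ^ (m - 1) * D g x"
proof (induction m)
  case 0
  then show ?case by (simp add: derivation_const)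
next
  case (Suc m)
  then have "D (\<lambda>y. g y ^ Suc m) x = D g x * g x ^ m + g x * (real m * g x ^ (m - 1) * D g x)"
    by (simp add: derivation_mult power_mem)
  \<comment> \<open>For \<open>m = 0\<close> the exponent \<open>m - 1\<close> is truncated, but the
    factor \<open>real m\<close> removes that term.\<close>
  also have "\<dots> = real (Suc m) * g x ^ m * D g x"
    by (cases m) (simp_all add: algebra_simps)
  finally show ?case by simp
qed

end

end

section \<open>First class constraints, clocks and the constraint ideal\<close>

text \<open>\<open>B\<close> is the inverse of the matrix of brackets between constraints and
  clocks. \<open>F\<close> is a fixed choice of the structure functions, which the first class
  property only asserts to exist.\<close>

locale gauge_fixed_constraints = poisson_algebra +
  fixes n :: nat and C T :: "nat \<Rightarrow> 'a \<Rightarrow> real" and B :: "nat \<Rightarrow> nat \<Rightarrow> 'a \<Rightarrow> real"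
    and F :: "nat \<Rightarrow> nat \<Rightarrow> nat \<Rightarrow> 'a \<Rightarrow> real"
  assumes C_mem: "i \<in> {1..n} \<Longrightarrow> C i \<in> R"
    and T_mem: "i \<in> {1..n} \<Longrightarrow> T i \<in> R"
    and B_mem: "\<lbrakk>i \<in> {1..n}; j \<in> {1..n}\<rbrakk> \<Longrightarrow> B i j \<in> R"
    and F_mem: "\<lbrakk>i \<in> {1..n}; j \<in> {1..n}; k \<in> {1..n}\<rbrakk> \<Longrightarrow> F i j k \<in> R"
    and pb_C_C: "\<lbrakk>i \<in> {1..n}; j \<in> {1..n}\<rbrakk> \<Longrightarrow> pb (C i) (C j) x = (\<Sum>k=1..n. F i j k x * C k x)"
    and inverse_B: "inverse_matrix n (\<lambda>j k. pb (C j) (T k) x) (\<lambda>j k. B j k x)"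
begin

abbreviation S where "S \<equiv> S_op pb n C B"

text \<open>Explicit combinations with coefficients in \<open>R\<close>, rather than functions
  vanishing on the hypersurface, so that stability under \<open>S j\<close> follows algebraically
  from the product rule and the structure functions.\<close>

definition constraint_ideal :: "('a \<Rightarrow> real) set" where
  "constraint_ideal = {h. \<exists>u. (\<forall>k\<in>{1..n}. u k \<in> R) \<and> h = (\<lambda>x. \<Sum>k=1..n. u k x * C k x)}"

lemma constraint_idealI:
  "\<lbrakk>\<And>k. k \<in> {1..n} \<Longrightarrow> u k \<in> R; \<And>x. h x = (\<Sum>k=1..n. u k x * C k x)\<rbrakk> \<Longrightarrow> h \<in> constraint_ideal"
  unfolding constraint_ideal_def by blast

lemma constraint_ideal_add:
  assumes "g \<in> constraint_ideal" "h \<in> constraint_ideal"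
  shows "(\<lambda>x. g x + h x) \<in> constraint_ideal"
proof -
  obtain u v where "\<forall>k\<in>{1..n}. u k \<in> R" "\<forall>k\<in>{1..n}. v k \<in> R"
    and gh: "g = (\<lambda>x. \<Sum>k=1..n. u k x * C k x)" "h = (\<lambda>x. \<Sum>k=1..n. v k x * C k x)"
    using assms unfolding constraint_ideal_def by blast
  then show ?thesis
    by (intro constraint_idealI[of "\<lambda>k x. u k x + v k x"])
      (simp_all add: add_mem sum.distrib algebra_simps)
qed

lemma constraint_ideal_mult:
  assumes "g \<in> constraint_ideal" "h \<in> R"
  shows "(\<lambda>x. h x * g x) \<in> constraint_ideal"
proof -
  obtain u where "\<forall>k\<in>{1..n}. u k \<in> R" "g = (\<lambda>x. \<Sum>k=1..n. u k x * C k x)"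
    using assms unfolding constraint_ideal_def by blast
  with assms(2) show ?thesis
    by (intro constraint_idealI[of "\<lambda>k x. h x * u k x"])
      (simp_all add: mult_mem sum_distrib_left algebra_simps)
qed

lemma constraint_ideal_zero: "(\<lambda>x. 0) \<in> constraint_ideal"
  by (intro constraint_idealI[of "\<lambda>k x. 0"]) (simp_all add: const_mem)

lemma constraint_ideal_sum:
  "(\<And>i. i \<in> I \<Longrightarrow> g i \<in> constraint_ideal) \<Longrightarrow> (\<lambda>x. \<Sum>i\<in>I. g i x) \<in> constraint_ideal"
  by (induction I rule: infinite_finite_induct)
    (simp_all add: constraint_ideal_zero constraint_ideal_add)

lemma constraint_mem_ideal:
  assumes "k \<in> {1..n}"
  shows "C k \<in> constraint_ideal"
  using assms
  by (intro constraint_idealI[of "\<lambda>i x. if i = k then 1 else 0"])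
    (simp_all add: const_mem if_distrib[of "\<lambda>z. z * _"] cong: if_cong)

lemma constraint_ideal_vanishes:
  "\<lbrakk>h \<in> constraint_ideal; x \<in> constraint_surface n C\<rbrakk> \<Longrightarrow> h x = 0"
  unfolding constraint_ideal_def constraint_surface_def by auto

lemma derivation_S:
  assumes "j \<in> {1..n}"
  shows "derivation (S j)"
proof -
  have lin: "(\<Sum>l\<in>L. b l * (r * p l + s * q l)) =
      r * (\<Sum>l\<in>L. b l * p l) + s * (\<Sum>l\<in>L. b l * q l)" for L :: "nat set" and b p q :: "nat \<Rightarrow> real" and r s
    by (simp add: sum_distrib_left sum.distrib algebra_simps)
  have leib: "(\<Sum>l\<in>L. b l * (p l * s + r * q l)) =
      (\<Sum>l\<in>L. b l * p l) * s + r * (\<Sum>l\<in>L. b l * q l)" for L :: "nat set" and b p q :: "nat \<Rightarrow> real" and r s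
    by (simp add: sum_distrib_left sum_distrib_right sum.distrib algebra_simps)
  have "(\<lambda>y. \<Sum>l=1..n. B j l y * pb (C l) g y) \<in> R" if "g \<in> R" for g
    by (intro sum_mem mult_mem B_mem pb_mem C_mem assms that)
  then show ?thesis
    unfolding derivation_def S_op_def
    by (simp add: C_mem pb_linear pb_leibniz flip: lin leib)
qed

lemmas S_mem = derivation_mem[OF derivation_S]

text \<open>The left side is an entry of the product of \<open>B\<close> with the bracket matrix, so
  the \<open>S j\<close> are derivations dual to the clocks.\<close>

lemma S_clock:
  assumes "j \<in> {1..n}" "k \<in> {1..n}"
  shows "S j (T k) x = (if j = k then 1 else 0)"
  using inverse_B[of x] assms unfolding inverse_matrix_def S_op_def by blast

text \<open>In the product rule for \<open>u k * C k\<close> one summand keeps the factor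
  \<open>C k\<close>; the other contains \<open>S j (C k)\<close>, a combination of brackets of
  constraints, which lie in the ideal by the first class property.\<close>

lemma constraint_ideal_S:
  assumes j: "j \<in> {1..n}" and h: "h \<in> constraint_ideal"
  shows "S j h \<in> constraint_ideal"
proof -
  obtain u where u: "\<And>k. k \<in> {1..n} \<Longrightarrow> u k \<in> R" and h_eq: "h = (\<lambda>x. \<Sum>k=1..n. u k x * C k x)"
    using h unfolding constraint_ideal_def by blast
  have S_C: "S j (C k) \<in> constraint_ideal" if "k \<in> {1..n}" for k
    unfolding S_op_def using j that
    by (intro constraint_ideal_sum constraint_ideal_mult B_mem constraint_idealI[of "F _ k", OF _ pb_C_C])
      (auto intro: F_mem)
  have "S j h = (\<lambda>x. \<Sum>k=1..n. S j (u k) x * C k x + u k x * S j (C k) x)"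
  proof (rule ext)
    fix x
    have "S j h x = (\<Sum>k=1..n. S j (\<lambda>x. u k x * C k x) x)"
      unfolding h_eq by (intro derivation_sum derivation_S j mult_mem u C_mem)
    also have "\<dots> = (\<Sum>k=1..n. S j (u k) x * C k x + u k x * S j (C k) x)"
      by (intro sum.cong refl derivation_mult derivation_S j u C_mem)
    finally show "S j h x = (\<Sum>k=1..n. S j (u k) x * C k x + u k x * S j (C k) x)" .
  qed
  also have "\<dots> \<in> constraint_ideal"
    by (intro constraint_ideal_sum constraint_ideal_add constraint_ideal_mult
        constraint_mem_ideal S_C u S_mem j) auto
  finally show ?thesis .
qed

section \<open>Commutators of the operators \<open>S j\<close>\<close>

lemma S_commutator_mem_ideal:
  assumes i: "i \<in> {1..n}" and j: "j \<in> {1..n}" and h: "h \<in> R"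
  shows "(\<lambda>x. S i (S j h) x - S j (S i h) x) \<in> constraint_ideal"
proof -
  \<comment> \<open>These are the coefficients in the expansion \<open>comm\<close> of the
    commutator: \<open>G m\<close> multiplies \<open>pb (C m) u\<close> and does not depend on
    \<open>u\<close>, while \<open>E u k\<close> multiplies \<open>C k\<close>.\<close>
  define G where "G m x = S i (B j m) x - S j (B i m) x +
    (\<Sum>l=1..n. \<Sum>k=1..n. B i l x * B j k x * F l k m x)" for m x
  define E where "E u k x = (\<Sum>l=1..n. \<Sum>m=1..n. B i l x * B j m x * pb (F l m k) u x)" for u k x
  have G_mem: "G m \<in> R" if "m \<in> {1..n}" for m
    unfolding G_def using that
    by (intro add_mem diff_mem sum_mem mult_mem S_mem B_mem F_mem i j)
  have E_mem: "E u k \<in> R" if "u \<in> R" "k \<in> {1..n}" for u k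
    unfolding E_def using that
    by (intro sum_mem mult_mem B_mem F_mem pb_mem i j)

  \<comment> \<open>Expanding by the product rule separates single brackets, with coefficients
    \<open>S a (B b m)\<close>, from iterated ones.\<close>
  have double: "S a (S b u) x = (\<Sum>m=1..n. S a (B b m) x * pb (C m) u x) +
      (\<Sum>l=1..n. \<Sum>m=1..n. B a l x * B b m x * pb (C l) (pb (C m) u) x)"
    if a: "a \<in> {1..n}" and b: "b \<in> {1..n}" and u: "u \<in> R" for a b u x
  proof -
    have "S a (S b u) x = S a (\<lambda>y. \<Sum>m=1..n. B b m y * pb (C m) u y) x"
      unfolding S_op_def[of _ _ _ _ b] ..
    also have "\<dots> = (\<Sum>m=1..n. S a (\<lambda>y. B b m y * pb (C m) u y) x)"
      by (intro derivation_sum derivation_S a mult_mem B_mem b pb_mem C_mem u)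
    also have "\<dots> = (\<Sum>m=1..n. S a (B b m) x * pb (C m) u x + B b m x * S a (pb (C m) u) x)"
      by (intro sum.cong refl derivation_mult derivation_S a B_mem b pb_mem C_mem u)
    also have "\<dots> = (\<Sum>m=1..n. S a (B b m) x * pb (C m) u x) +
        (\<Sum>m=1..n. \<Sum>l=1..n. B a l x * B b m x * pb (C l) (pb (C m) u) x)"
      by (simp add: S_op_def[of _ _ _ _ a "pb _ _"] sum.distrib sum_distrib_left mult_ac)
    finally show ?thesis
      by (subst sum.swap)
  qed

  \<comment> \<open>The Jacobi identity reduces the antisymmetrized double bracket to the bracket of
    \<open>pb (C l) (C m)\<close> with \<open>u\<close>, and the first class property expands the
    latter.\<close>
  have jac: "pb (C l) (pb (C m) u) x - pb (C m) (pb (C l) u) x =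
      (\<Sum>k=1..n. pb (F l m k) u x * C k x) + (\<Sum>k=1..n. F l m k x * pb (C k) u x)"
    if l: "l \<in> {1..n}" and m: "m \<in> {1..n}" and u: "u \<in> R" for l m u x
  proof -
    note mem = C_mem[OF l] C_mem[OF m] u
    have "pb (C m) (pb u (C l)) x = pb (C m) (\<lambda>y. - pb (C l) u y) x"
      using pb_skew[OF u C_mem[OF l]] by (metis ext)
    also have "\<dots> = - pb (C m) (pb (C l) u) x"
      by (intro derivation_uminus derivation_pb pb_mem mem)
    finally have "pb (C l) (pb (C m) u) x - pb (C m) (pb (C l) u) x = - pb u (pb (C l) (C m)) x"
      using jacobi[OF C_mem[OF l] C_mem[OF m] u, of x] by simp
    also have "\<dots> = - pb u (\<lambda>x. \<Sum>k=1..n. F l m k x * C k x) x"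
      using pb_C_C[OF l m] by (metis ext)
    also have "\<dots> = - (\<Sum>k=1..n. pb u (\<lambda>x. F l m k x * C k x) x)"
      by (intro arg_cong[where f=uminus] derivation_sum derivation_pb u mult_mem F_mem C_mem l m)
    also have "\<dots> = - (\<Sum>k=1..n. pb u (F l m k) x * C k x + F l m k x * pb u (C k) x)"
      by (intro arg_cong[where f=uminus] sum.cong refl pb_leibniz u F_mem C_mem l m)
    also have "\<dots> = (\<Sum>k=1..n. pb (F l m k) u x * C k x + F l m k x * pb (C k) u x)"
      unfolding sum_negf[symmetric]
      by (intro sum.cong refl) (simp add: pb_skew[OF u F_mem[OF l m]] pb_skew[OF u C_mem])
    finally show ?thesis by (simp add: sum.distrib)
  qed

  have comm: "S i (S j u) x - S j (S i u) x =
      (\<Sum>m=1..n. G m x * pb (C m) u x) + (\<Sum>k=1..n. E u k x * C k x)" if u: "u \<in> R" for u x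
  proof -
    let ?N = "{1..n}"
    have factor: "(\<Sum>l\<in>?N. \<Sum>m\<in>?N. \<Sum>k\<in>?N. w l m k * c k) =
        (\<Sum>k\<in>?N. (\<Sum>l\<in>?N. \<Sum>m\<in>?N. w l m k) * c k)" for w :: "nat \<Rightarrow> nat \<Rightarrow> nat \<Rightarrow> real" and c
    proof -
      have "(\<Sum>l\<in>?N. \<Sum>m\<in>?N. \<Sum>k\<in>?N. w l m k * c k) =
          (\<Sum>l\<in>?N. \<Sum>k\<in>?N. \<Sum>m\<in>?N. w l m k * c k)"
        by (intro sum.cong refl sum.swap)
      also have "\<dots> = (\<Sum>k\<in>?N. \<Sum>l\<in>?N. \<Sum>m\<in>?N. w l m k * c k)"
        by (rule sum.swap)
      finally show ?thesis by (simp add: sum_distrib_right)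
    qed
    \<comment> \<open>Exchanging \<open>l\<close> and \<open>m\<close> in one double sum aligns the
      coefficients, so the iterated brackets enter only through the difference treated by
      \<open>jac\<close>.\<close>
    have "(\<Sum>l\<in>?N. \<Sum>m\<in>?N. B j l x * B i m x * pb (C l) (pb (C m) u) x) =
        (\<Sum>l\<in>?N. \<Sum>m\<in>?N. B i l x * B j m x * pb (C m) (pb (C l) u) x)"
      by (subst sum.swap) (simp add: mult_ac)
    then have "(\<Sum>l\<in>?N. \<Sum>m\<in>?N. B i l x * B j m x * pb (C l) (pb (C m) u) x) -
        (\<Sum>l\<in>?N. \<Sum>m\<in>?N. B j l x * B i m x * pb (C l) (pb (C m) u) x) =
        (\<Sum>l\<in>?N. \<Sum>m\<in>?N. B i l x * B j m x *
          (pb (C l) (pb (C m) u) x - pb (C m) (pb (C l) u) x))"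
      by (simp add: sum_subtractf right_diff_distrib)
    also have "\<dots> = (\<Sum>l\<in>?N. \<Sum>m\<in>?N. B i l x * B j m x *
        ((\<Sum>k\<in>?N. pb (F l m k) u x * C k x) + (\<Sum>k\<in>?N. F l m k x * pb (C k) u x)))"
      by (intro sum.cong refl) (simp add: jac u)
    also have "\<dots> = (\<Sum>l\<in>?N. \<Sum>m\<in>?N. \<Sum>k\<in>?N. B i l x * B j m x * pb (F l m k) u x * C k x) +
        (\<Sum>l\<in>?N. \<Sum>m\<in>?N. \<Sum>k\<in>?N. B i l x * B j m x * F l m k x * pb (C k) u x)"
      by (simp add: distrib_left sum_distrib_left sum.distrib mult_ac)
    also have "(\<Sum>l\<in>?N. \<Sum>m\<in>?N. \<Sum>k\<in>?N. B i l x * B j m x * pb (F l m k) u x * C k x) =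
        (\<Sum>k\<in>?N. E u k x * C k x)"
      unfolding E_def by (rule factor)
    also have "(\<Sum>l\<in>?N. \<Sum>m\<in>?N. \<Sum>k\<in>?N. B i l x * B j m x * F l m k x * pb (C k) u x) =
        (\<Sum>k\<in>?N. (\<Sum>l\<in>?N. \<Sum>m\<in>?N. B i l x * B j m x * F l m k x) * pb (C k) u x)"
      by (rule factor)
    finally show ?thesis
      unfolding double[OF i j u] double[OF j i u] G_def
      by (simp add: distrib_right left_diff_distrib sum.distrib sum_subtractf)
  qed

  \<comment> \<open>Evaluate \<open>comm\<close> at the clocks: each \<open>S b (T q)\<close> is
    constant, so the left side vanishes and \<open>G\<close> times the bracket matrix lies in the
    ideal. Multiplying by \<open>B\<close> isolates \<open>G m\<close>.\<close>
  have G_ideal: "G m \<in> constraint_ideal" if m: "m \<in> {1..n}" for m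
  proof -
    have "(\<Sum>k=1..n. G k x * pb (C k) (T q) x) = - (\<Sum>k=1..n. E (T q) k x * C k x)"
      if q: "q \<in> {1..n}" for q x
    proof -
      have const: "S a (S b (T q)) x = 0" if "a \<in> {1..n}" "b \<in> {1..n}" for a b
      proof -
        have "S b (T q) = (\<lambda>_. if b = q then 1 else 0)"
          using S_clock[OF that(2) q] by auto
        then show ?thesis
          using derivation_const[OF derivation_S[OF that(1)]] by simp
      qed
      show ?thesis
        using comm[OF T_mem[OF q], of x] const i j by simp
    qed
    note G_A = this
    have "G m x = (\<Sum>k=1..n. (- (\<Sum>q=1..n. E (T q) k x * B q m x)) * C k x)" for x
    proof -
      have "G m x = (\<Sum>k=1..n. G k x * (if k = m then 1 else 0))"
        using m by (simp add: if_distrib[of "\<lambda>z. _ * z"] cong: if_cong)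
      also have "\<dots> = (\<Sum>k=1..n. G k x * (\<Sum>q=1..n. pb (C k) (T q) x * B q m x))"
        using inverse_B[of x] m unfolding inverse_matrix_def by (intro sum.cong refl) auto
      also have "\<dots> = (\<Sum>q=1..n. (\<Sum>k=1..n. G k x * pb (C k) (T q) x) * B q m x)"
        unfolding sum_distrib_left sum_distrib_right by (subst sum.swap) (simp add: mult_ac)
      also have "\<dots> = (\<Sum>q=1..n. - (\<Sum>k=1..n. E (T q) k x * C k x) * B q m x)"
        by (intro sum.cong refl) (simp only: G_A)
      also have "\<dots> = (\<Sum>k=1..n. (- (\<Sum>q=1..n. E (T q) k x * B q m x)) * C k x)"
        unfolding sum_distrib_right sum_negf[symmetric] by (subst sum.swap) (simp add: mult_ac)
      finally show ?thesis .
    qed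
    then show ?thesis
      by (rule constraint_idealI[rotated]) (intro uminus_mem sum_mem mult_mem E_mem T_mem B_mem m)
  qed
  have "(\<lambda>x. (\<Sum>m=1..n. pb (C m) h x * G m x) + (\<Sum>k=1..n. E h k x * C k x)) \<in> constraint_ideal"
    by (intro constraint_ideal_add constraint_ideal_sum constraint_ideal_mult G_ideal
        constraint_mem_ideal E_mem pb_mem C_mem h)
  then show ?thesis
    unfolding comm[OF h] by (simp add: mult.commute)
qed

section \<open>Weak equality and reordering of the iterates\<close>

text \<open>Congruence modulo the ideal, not mere equality on the hypersurface: by
  \<open>constraint_ideal_S\<close> it may be acted on again by the \<open>S j\<close>.\<close>

definition weakly_equal :: "('a \<Rightarrow> real) \<Rightarrow> ('a \<Rightarrow> real) \<Rightarrow> bool" where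
  "weakly_equal g h \<longleftrightarrow> (\<lambda>x. g x - h x) \<in> constraint_ideal"

lemma weakly_equal_refl: "weakly_equal g g"
  by (simp add: weakly_equal_def constraint_ideal_zero)

lemma weakly_equal_trans [trans]:
  "\<lbrakk>weakly_equal g h; weakly_equal h u\<rbrakk> \<Longrightarrow> weakly_equal g u"
  unfolding weakly_equal_def
  using constraint_ideal_add[of "\<lambda>x. g x - h x" "\<lambda>x. h x - u x"] by simp

lemma weakly_equal_S:
  assumes "i \<in> {1..n}" "g \<in> R" "h \<in> R" "weakly_equal g h"
  shows "weakly_equal (S i g) (S i h)"
  using constraint_ideal_S[OF assms(1) assms(4)[unfolded weakly_equal_def]]
  unfolding weakly_equal_def derivation_diff[OF derivation_S[OF assms(1)] assms(2,3), symmetric] .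

lemma S_power_mem: "\<lbrakk>i \<in> {1..n}; g \<in> R\<rbrakk> \<Longrightarrow> (S i ^^ m) g \<in> R"
  by (induction m) (simp_all add: S_mem)

lemma weakly_equal_S_power:
  "\<lbrakk>i \<in> {1..n}; g \<in> R; h \<in> R; weakly_equal g h\<rbrakk> \<Longrightarrow> weakly_equal ((S i ^^ m) g) ((S i ^^ m) h)"
  by (induction m) (simp_all add: weakly_equal_S S_power_mem)

lemma weakly_equal_S_commute_power:
  assumes i: "i \<in> {1..n}" and j: "j \<in> {1..n}" and g: "g \<in> R"
  shows "weakly_equal (S j ((S i ^^ m) g)) ((S i ^^ m) (S j g))"
proof (induction m)
  case 0
  then show ?case by (simp add: weakly_equal_refl)
next
  case (Suc m)
  have "weakly_equal (S j (S i ((S i ^^ m) g))) (S i (S j ((S i ^^ m) g)))"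
    unfolding weakly_equal_def
    by (intro S_commutator_mem_ideal i j S_power_mem g)
  also have "weakly_equal \<dots> (S i ((S i ^^ m) (S j g)))"
    by (intro weakly_equal_S Suc i S_mem S_power_mem j g)
  finally show ?case by simp
qed

lemma S_foldr_mem:
  "\<lbrakk>set js \<subseteq> {1..n}; g \<in> R\<rbrakk> \<Longrightarrow> foldr (\<lambda>j. S j ^^ k j) js g \<in> R"
  by (induction js) (simp_all add: S_power_mem)

text \<open>\<open>S j\<close> is moved inwards past the powers of the other operators until it
  meets its own power, whose exponent it raises.\<close>

lemma weakly_equal_S_foldr:
  assumes "distinct js" "j \<in> set js" "set js \<subseteq> {1..n}" "g \<in> R"
  shows "weakly_equal (S j (foldr (\<lambda>i. S i ^^ k i) js g))
    (foldr (\<lambda>i. S i ^^ (k(j := Suc (k j))) i) js g)"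
  using assms
proof (induction js)
  case Nil
  then show ?case by simp
next
  case (Cons i js)
  let ?k = "k(j := Suc (k j))"
  let ?X = "foldr (\<lambda>i. S i ^^ k i) js g" and ?Y = "foldr (\<lambda>i. S i ^^ ?k i) js g"
  have i: "i \<in> {1..n}" and j: "j \<in> {1..n}" and mem: "?X \<in> R" "?Y \<in> R"
    using Cons.prems S_foldr_mem by auto
  show ?case
  proof (cases "i = j")
    case True
    \<comment> \<open>By distinctness \<open>j\<close> does not recur in the tail, so the changed
      exponent is not seen there.\<close>
    then have "?X = ?Y"
      using Cons.prems by (intro foldr_cong) auto
    with True show ?thesis
      by (simp add: weakly_equal_refl)
  next
    case False
    have "weakly_equal (S j ((S i ^^ k i) ?X)) ((S i ^^ k i) (S j ?X))"
      by (intro weakly_equal_S_commute_power i j mem)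
    also have "weakly_equal \<dots> ((S i ^^ k i) ?Y)"
      using Cons False by (intro weakly_equal_S_power i S_mem j mem) auto
    finally show ?thesis
      using False by simp
  qed
qed

lemma S_iter_mem: "g \<in> R \<Longrightarrow> S_iter pb n C B k g \<in> R"
  unfolding S_iter_def by (intro S_foldr_mem) auto

lemma S_S_iter_on_surface:
  assumes "j \<in> {1..n}" "g \<in> R" "x \<in> constraint_surface n C"
  shows "S j (S_iter pb n C B k g) x = S_iter pb n C B (k(j := Suc (k j))) g x"
proof -
  have "weakly_equal (S j (S_iter pb n C B k g)) (S_iter pb n C B (k(j := Suc (k j))) g)"
    unfolding S_iter_def using assms by (intro weakly_equal_S_foldr) auto
  then show ?thesis
    using constraint_ideal_vanishes[OF _ assms(3)] unfolding weakly_equal_def by fastforce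
qed

section \<open>Action of \<open>S j\<close> on the terms of the series\<close>

lemma series_term_mem: "g \<in> R \<Longrightarrow> series_term pb n C B T g \<tau> k \<in> R"
  unfolding series_term_def
  by (intro mult_mem const_mem S_iter_mem prod_mem power_mem diff_mem T_mem)

text \<open>
  The \<open>k\<close>-th term of the formal \<open>\<tau>\<^sub>j\<close>-derivative of the series; for \<open>k\<^sub>j = 0\<close> the exponent \<open>k\<^sub>j - 1\<close> is
  truncated to \<open>0\<close>, but the factor \<open>k\<^sub>j\<close> vanishes.
\<close>

definition shifted_term :: "('a \<Rightarrow> real) \<Rightarrow> (nat \<Rightarrow> real) \<Rightarrow> nat \<Rightarrow> 'a \<Rightarrow> (nat \<Rightarrow> nat) \<Rightarrow> real" where
  "shifted_term g \<tau> j y k = real (k j) / (\<Prod>i=1..n. fact (k i)) * S_iter pb n C B k g y *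
    ((\<tau> j - T j y) ^ (k j - 1) * (\<Prod>i\<in>{1..n} - {j}. (\<tau> i - T i y) ^ k i))"

text \<open>The extra factor restores the power lost by differentiation; for \<open>k j = 0\<close>
  both sides are zero.\<close>

lemma shifted_term_mult:
  assumes "j \<in> {1..n}"
  shows "shifted_term g \<tau> j y k * (\<tau> j - T j y) = real (k j) * series_term pb n C B T g \<tau> k y"
proof -
  have "(\<Prod>i=1..n. (\<tau> i - T i y) ^ k i) =
      (\<tau> j - T j y) ^ k j * (\<Prod>i\<in>{1..n} - {j}. (\<tau> i - T i y) ^ k i)"
    using assms by (subst prod.remove[of _ j]) auto
  then show ?thesis
    unfolding shifted_term_def series_term_def by (cases "k j") simp_all
qed

text \<open>By the product rule, \<open>S j\<close> raises the index of the iterate (here the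
  hypersurface enters), lowers the power of the \<open>j\<close>-th clock difference, and kills the
  other differences by duality. The first two effects are neighbouring values of
  \<open>shifted_term\<close>.\<close>

lemma S_series_term:
  assumes j: "j \<in> {1..n}" and g: "g \<in> R" and y: "y \<in> constraint_surface n C"
  shows "S j (series_term pb n C B T g \<tau> k) y =
    shifted_term g \<tau> j y (k(j := Suc (k j))) - shifted_term g \<tau> j y k"
proof -
  let ?c = "1 / (\<Prod>i=1..n. fact (k i)) :: real" and ?f = "S_iter pb n C B k g"
  let ?p = "\<lambda>y. (\<tau> j - T j y) ^ k j" and ?q = "\<lambda>y. \<Prod>i\<in>{1..n} - {j}. (\<tau> i - T i y) ^ k i"
  note D = derivation_S[OF j]
  have diff_T: "(\<lambda>y. \<tau> i - T i y) \<in> R" if "i \<in> {1..n}" for i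
    using that by (intro diff_mem const_mem T_mem)
  have S_diff: "S j (\<lambda>y. \<tau> i - T i y) y = (if i = j then - 1 else 0)" if "i \<in> {1..n}" for i
    using derivation_diff[OF D const_mem T_mem[OF that]] derivation_const[OF D] S_clock[OF j that]
    by simp
  have mem: "?f \<in> R" "?p \<in> R" "?q \<in> R"
    using j by (auto intro!: S_iter_mem g power_mem prod_mem diff_T)
  have S_p: "S j ?p y = - real (k j) * (\<tau> j - T j y) ^ (k j - 1)"
    using derivation_power[OF D diff_T[OF j]] S_diff[OF j] by simp
  have S_q: "S j ?q y = 0"
    using derivation_power[OF D diff_T] S_diff
    by (intro derivation_prod_eq_0 D) (auto intro!: power_mem diff_T)
  \<comment> \<open>The factor gained by the factorials cancels the numerator of the raised
    \<open>shifted_term\<close>.\<close>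
  have fact_eq: "(\<Prod>i=1..n. fact ((k(j := Suc (k j))) i)) = real (Suc (k j)) * (\<Prod>i=1..n. fact (k i))"
    using j by (simp add: prod.remove[of _ j] algebra_simps)
  have "series_term pb n C B T g \<tau> k = (\<lambda>y. ?c * (?f y * (?p y * ?q y)))"
    using j by (simp add: fun_eq_iff series_term_def prod.remove[of _ j])
  then have "S j (series_term pb n C B T g \<tau> k) y = S j (\<lambda>y. ?c * (?f y * (?p y * ?q y))) y"
    by simp
  also have "\<dots> = ?c * S j (\<lambda>y. ?f y * (?p y * ?q y)) y"
    by (intro derivation_cmult D mult_mem mem)
  also have "\<dots> = ?c * (S j ?f y * (?p y * ?q y) + ?f y * (S j ?p y * ?q y + ?p y * S j ?q y))"
    by (simp only: derivation_mult[OF D] mult_mem mem)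
  also have "\<dots> = ?c * S_iter pb n C B (k(j := Suc (k j))) g y * (?p y * ?q y) -
      real (k j) * ?c * ?f y * ((\<tau> j - T j y) ^ (k j - 1) * ?q y)"
    unfolding S_S_iter_on_surface[OF j g y] S_p S_q by (simp add: algebra_simps)
  also have "?c * S_iter pb n C B (k(j := Suc (k j))) g y * (?p y * ?q y) =
      shifted_term g \<tau> j y (k(j := Suc (k j)))"
    unfolding shifted_term_def fact_eq by simp
  finally show ?thesis
    by (simp add: shifted_term_def)
qed

end

section \<open>Telescoping and summation along coordinate lines\<close>

text \<open>
  The partial sums telescope to \<open>a\<close>, whose limit can only be nonzero if \<open>c \<noteq> 0\<close>; but then the terms
  \<open>b m = c * a m / m\<close> would be those of a harmonic series.
\<close>

lemma telescoping_has_sum_0: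
  fixes a b :: "nat \<Rightarrow> real"
  assumes diff: "(\<lambda>m. a (Suc m) - a m) summable_on UNIV" and b: "b summable_on UNIV"
    and ab: "\<And>m. a m * c = real m * b m"
    and a_0: "a 0 = 0" and c_0: "\<And>m. \<lbrakk>c = 0; m \<ge> 2\<rbrakk> \<Longrightarrow> a m = 0"
  shows "((\<lambda>m. a (Suc m) - a m) has_sum 0) UNIV"
proof -
  obtain L where L: "((\<lambda>m. a (Suc m) - a m) has_sum L) UNIV"
    using diff unfolding summable_on_def by blast
  then have "(\<lambda>N. \<Sum>m<N. a (Suc m) - a m) \<longlonglongrightarrow> L"
    using has_sum_imp_sums unfolding sums_def by blast
  then have lim: "a \<longlonglongrightarrow> L"
    by (simp add: sum_lessThan_telescope a_0)
  have "L = 0"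
  proof (cases "c = 0")
    case True
    then have "eventually (\<lambda>m. a m = 0) sequentially"
      using c_0 by (intro eventually_sequentiallyI[of 2])
    then have "a \<longlonglongrightarrow> 0"
      by (simp add: tendsto_eventually)
    with lim show ?thesis by (rule LIMSEQ_unique)
  next
    case False
    show ?thesis
    proof (rule ccontr)
      assume "L \<noteq> 0"
      have "eventually (\<lambda>m. \<bar>L\<bar> / 2 < \<bar>a m\<bar>) sequentially"
        using order_tendstoD(1)[OF tendsto_rabs[OF lim], of "\<bar>L\<bar> / 2"] \<open>L \<noteq> 0\<close> by simp
      \<comment> \<open>Once \<open>a\<close> stays away from zero by half its limit,
        \<open>ab\<close> bounds 1 / m by a constant multiple of
        \<open>\<bar>b m\<bar>\<close>.\<close>
      then have "eventually (\<lambda>m. norm (inverse (real m)) \<le> 2 / (\<bar>L\<bar> * \<bar>c\<bar>) * \<bar>b m\<bar>) sequentially"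
        using eventually_gt_at_top[of 0]
      proof eventually_elim
        case (elim m)
        have "\<bar>L\<bar> / 2 * \<bar>c\<bar> \<le> \<bar>a m\<bar> * \<bar>c\<bar>"
          using elim by (intro mult_right_mono) auto
        also have "\<dots> = real m * \<bar>b m\<bar>"
          using ab[of m] by (metis abs_mult abs_of_nat)
        finally show ?case
          using elim \<open>L \<noteq> 0\<close> False by (simp add: field_simps)
      qed
      \<comment> \<open>Unordered summability of reals is absolute, which the comparison
        requires.\<close>
      moreover have "summable (\<lambda>m. \<bar>b m\<bar>)"
        using summable_on_iff_abs_summable_on_real[THEN iffD1, OF b]
        by (intro summable_on_imp_summable) (simp only: real_norm_def)
      then have "summable (\<lambda>m. 2 / (\<bar>L\<bar> * \<bar>c\<bar>) * \<bar>b m\<bar>)"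
        by (rule summable_mult)
      ultimately have "summable (\<lambda>m. inverse (real m))"
        by (rule summable_comparison_test_ev)
      then show False
        using not_summable_harmonic by blast
    qed
  qed
  with L show ?thesis by simp
qed

text \<open>The multi-indices split into lines in direction \<open>j\<close>, each with a unique
  base point whose \<open>j\<close>-th entry is zero.\<close>

lemma bij_betw_lines:
  assumes "j \<in> J"
  shows "bij_betw (\<lambda>(k, m). k(j := m)) ({k \<in> J \<rightarrow>\<^sub>E UNIV. k j = (0::nat)} \<times> UNIV) (J \<rightarrow>\<^sub>E UNIV)"
  using assms
  by (intro bij_betw_byWitness[where f' = "\<lambda>k. (k(j := 0), k j)"])
    (auto simp: PiE_iff extensional_def)

text \<open>An unordered sum may be regrouped along lines, and here every inner sum is zero.
  Summability on each line is inherited from \<open>d\<close>, so \<open>line\<close> may presuppose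
  it.\<close>

lemma has_sum_lines_0:
  fixes d :: "(nat \<Rightarrow> nat) \<Rightarrow> real"
  assumes j: "j \<in> {1..n}" and d: "(d has_sum s) (multi_indices n)"
    and line: "\<And>k. \<lbrakk>k \<in> multi_indices n; (\<lambda>m. d (k(j := m))) summable_on UNIV\<rbrakk> \<Longrightarrow>
      ((\<lambda>m. d (k(j := m))) has_sum 0) UNIV"
  shows "s = 0"
proof -
  let ?K = "{k \<in> multi_indices n. k j = 0}"
  have sum: "((\<lambda>(k, m). d (k(j := m))) has_sum s) (?K \<times> UNIV)"
    using d has_sum_reindex_bij_betw[OF bij_betw_lines[OF j], of d s]
    unfolding multi_indices_def by (simp add: case_prod_unfold)
  have "((\<lambda>m. d (k(j := m))) has_sum 0) UNIV" if "k \<in> ?K" for k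
    using that line summable_on_SigmaD1[OF has_sum_imp_summable[OF sum], of k] by auto
  then have "((\<lambda>k. 0) has_sum s) ?K"
    using has_sum_SigmaD[OF sum, of "\<lambda>_. 0"] by simp
  then show ?thesis
    using has_sum_unique has_sum_0_simp by blast
qed

lemma summable_on_line:
  fixes t :: "(nat \<Rightarrow> nat) \<Rightarrow> real"
  assumes "t summable_on multi_indices n" "k \<in> multi_indices n" "j \<in> {1..n}"
  shows "(\<lambda>m. t (k(j := m))) summable_on UNIV"
proof -
  have "t summable_on range (\<lambda>m. k(j := m))"
    using assms(2,3)
    by (intro summable_on_subset_banach[OF assms(1)]) (auto simp: multi_indices_def PiE_iff extensional_def)
  moreover have "inj (\<lambda>m. k(j := m))"
    by (rule injI) (metis fun_upd_same)
  ultimately show ?thesis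
    by (simp add: summable_on_reindex o_def)
qed

section \<open>Smooth functions as a Poisson algebra, and the theorem\<close>

lemma poisson_algebra_smooth_fun:
  assumes atlas: "smooth_atlas \<A>" and bracket: "poisson_bracket \<A> pb"
  shows "poisson_algebra (Collect (smooth_fun \<A>)) pb"
proof
  show "(\<lambda>_. r) \<in> Collect (smooth_fun \<A>)" for r
    by (simp add: smooth_fun_const)
next
  fix g h :: "'a \<Rightarrow> real" and x
  assume "g \<in> Collect (smooth_fun \<A>)" "h \<in> Collect (smooth_fun \<A>)"
  then have gh: "smooth_fun \<A> g" "smooth_fun \<A> h"
    by simp_all
  from gh show "(\<lambda>x. g x + h x) \<in> Collect (smooth_fun \<A>)" "(\<lambda>x. g x * h x) \<in> Collect (smooth_fun \<A>)"
    by (simp_all add: smooth_fun_add[OF atlas] smooth_fun_mult[OF atlas])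
  note ax = bracket[unfolded poisson_bracket_def, THEN conjunct1, THEN spec, THEN spec,
      THEN mp, THEN mp, OF gh]
  show "pb g h \<in> Collect (smooth_fun \<A>)"
    using ax[THEN conjunct1] by (simp only: mem_Collect_eq)
  show "pb g h x = - pb h g x"
    using ax[THEN conjunct2] by (rule spec)
next
  fix u g h :: "'a \<Rightarrow> real" and x r s
  assume "u \<in> Collect (smooth_fun \<A>)" "g \<in> Collect (smooth_fun \<A>)" "h \<in> Collect (smooth_fun \<A>)"
  then have ugh: "smooth_fun \<A> u" "smooth_fun \<A> g" "smooth_fun \<A> h"
    by simp_all
  note ax = bracket[unfolded poisson_bracket_def, THEN conjunct2, THEN conjunct1,
      THEN spec, THEN spec, THEN spec, THEN mp, THEN mp, THEN mp, OF ugh]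
  show "pb u (\<lambda>y. r * g y + s * h y) x = r * pb u g x + s * pb u h x"
    using ax[THEN conjunct1] by blast
  show "pb u (\<lambda>y. g y * h y) x = pb u g x * h x + g x * pb u h x"
    using ax[THEN conjunct2, THEN conjunct1] by (rule spec)
  show "pb u (pb g h) x + pb g (pb h u) x + pb h (pb u g) x = 0"
    using ax[THEN conjunct2, THEN conjunct2] by (rule spec)
qed

theorem mainTheorem5:
  fixes \<A> :: "('a::{t2_space, second_countable_topology}, 'e::euclidean_space) chart set"
    and pb :: "('a \<Rightarrow> real) \<Rightarrow> ('a \<Rightarrow> real) \<Rightarrow> ('a \<Rightarrow> real)"
    and n p :: nat
    and C T :: "nat \<Rightarrow> 'a \<Rightarrow> real"
    and Ainv :: "nat \<Rightarrow> nat \<Rightarrow> 'a \<Rightarrow> real"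
    and f :: "'a \<Rightarrow> real"
    and \<tau>\<^sub>0 :: "nat \<Rightarrow> real"
    and U :: "'a set" and x\<^sub>0 :: 'a
  assumes manifold: "smooth_atlas \<A>" "DIM('e) = 2 * p"
    and bracket: "poisson_bracket \<A> pb" "nondegenerate \<A> pb"
    and n_less: "n < p"
    and constraints_smooth: "\<And>i. i \<in> {1..n} \<Longrightarrow> smooth_fun \<A> (C i)"
    and independent_constraints: "submanifold \<A> (2 * p - n) (constraint_surface n C)"
    and first_class_constraints: "first_class \<A> pb n C"
    and clocks_smooth: "\<And>i. i \<in> {1..n} \<Longrightarrow> smooth_fun \<A> (T i)"
    and A_invertible: "\<And>x. inverse_matrix n (\<lambda>j k. pb (C j) (T k) x) (\<lambda>j k. Ainv j k x)"
    and Ainv_smooth: "\<And>j k. j \<in> {1..n} \<Longrightarrow> k \<in> {1..n} \<Longrightarrow> smooth_fun \<A> (Ainv j k)"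
    and f_smooth: "smooth_fun \<A> f"
    and neighbourhood: "open U" "x\<^sub>0 \<in> U"
    and convergence: "\<And>y. y \<in> U \<Longrightarrow>
      (\<lambda>k. series_term pb n C Ainv T f \<tau>\<^sub>0 k y) summable_on multi_indices n"
    and permutable: "termwise_differentiable_on \<A> U (multi_indices n)
      (series_term pb n C Ainv T f \<tau>\<^sub>0) (series_sum pb n C Ainv T f \<tau>\<^sub>0)"
  shows "complete_observable_on \<A> pb n C U (series_sum pb n C Ainv T f \<tau>\<^sub>0)"
  unfolding complete_observable_on_def
proof (intro conjI ballI)
  let ?t = "series_term pb n C Ainv T f \<tau>\<^sub>0" and ?F = "series_sum pb n C Ainv T f \<tau>\<^sub>0"
  show "differentiable_at \<A> ?F y" if "y \<in> U" for y
    using permutable that unfolding termwise_differentiable_on_def by blast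
  obtain \<Phi> where \<Phi>: "\<forall>i\<in>{1..n}. \<forall>j\<in>{1..n}. \<forall>k\<in>{1..n}. smooth_fun \<A> (\<Phi> i j k)"
    "\<forall>i\<in>{1..n}. \<forall>j\<in>{1..n}. \<forall>x. pb (C i) (C j) x = (\<Sum>k=1..n. \<Phi> i j k x * C k x)"
    using first_class_constraints unfolding first_class_def by blast
  interpret poisson_algebra "Collect (smooth_fun \<A>)" pb
    by (rule poisson_algebra_smooth_fun[OF manifold(1) bracket(1)])
  interpret gauge_fixed_constraints "Collect (smooth_fun \<A>)" pb n C T Ainv \<Phi>
  proof
    show "inverse_matrix n (\<lambda>j k. pb (C j) (T k) x) (\<lambda>j k. Ainv j k x)" for x
      by (rule A_invertible)
  qed (use \<Phi> in \<open>simp_all add: constraints_smooth clocks_smooth Ainv_smooth\<close>)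

  fix q y
  assume q: "q \<in> {1..n}" and y: "y \<in> U \<inter> constraint_surface n C"
  have t_smooth: "smooth_fun \<A> (?t k)" for k
    using series_term_mem f_smooth by simp
  \<comment> \<open>Skew symmetry is available for the smooth terms but not for their sum, so the
    arguments are exchanged termwise; this brings \<open>C l\<close> into the slot it has in
    \<open>S_op\<close>.\<close>
  have pb_F: "((\<lambda>k. - pb (C l) (?t k) y) has_sum pb ?F (C l) y) (multi_indices n)"
    if l: "l \<in> {1..n}" for l
  proof -
    have "((\<lambda>k. pb (?t k) (C l) y) has_sum pb ?F (C l) y) (multi_indices n)"
      using y
      by (intro pb_has_sum[OF manifold(1) bracket(1) _ _ permutable] smooth_fun_imp_differentiable_at
          t_smooth constraints_smooth l) auto
    moreover have "pb (?t k) (C l) y = - pb (C l) (?t k) y" for k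
      by (rule pb_skew) (simp_all only: mem_Collect_eq t_smooth constraints_smooth l)
    ultimately show ?thesis
      by (simp only:)
  qed
  \<comment> \<open>Up to sign this is \<open>S j\<close> applied termwise to the series; it is
    shown to vanish by summing along lines in direction \<open>j\<close>.\<close>
  have S_F: "(\<Sum>l=1..n. Ainv j l y * pb ?F (C l) y) = 0" if j: "j \<in> {1..n}" for j
  proof (rule has_sum_lines_0[OF j])
    let ?a = "shifted_term f \<tau>\<^sub>0 j y"
    have "((\<lambda>k. \<Sum>l=1..n. Ainv j l y * - pb (C l) (?t k) y) has_sum
        (\<Sum>l=1..n. Ainv j l y * pb ?F (C l) y)) (multi_indices n)"
      by (intro has_sum_finite_sum has_sum_cmult_right pb_F)
    moreover have "(\<Sum>l=1..n. Ainv j l y * - pb (C l) (?t k) y) =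
        - (?a (k(j := Suc (k j))) - ?a k)" for k
      using S_series_term[OF j, of f y \<tau>\<^sub>0 k] f_smooth y by (simp add: S_op_def sum_negf)
    ultimately show "((\<lambda>k. - (?a (k(j := Suc (k j))) - ?a k)) has_sum
        (\<Sum>l=1..n. Ainv j l y * pb ?F (C l) y)) (multi_indices n)"
      by (simp only:)
    fix k
    assume k: "k \<in> multi_indices n"
      and sum: "(\<lambda>m. - (?a ((k(j := m))(j := Suc ((k(j := m)) j))) - ?a (k(j := m)))) summable_on UNIV"
    \<comment> \<open>Here \<open>c\<close> is the clock difference
      \<open>\<tau>\<^sub>0 j - T j y\<close> and \<open>b\<close> is the original series on the
      line.\<close>
    have "((\<lambda>m. ?a (k(j := Suc m)) - ?a (k(j := m))) has_sum 0) UNIV"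
    proof (rule telescoping_has_sum_0)
      show "(\<lambda>m. ?a (k(j := Suc m)) - ?a (k(j := m))) summable_on UNIV"
        using sum[unfolded summable_on_uminus] by simp
      show "(\<lambda>m. ?t (k(j := m)) y) summable_on UNIV"
        using y by (intro summable_on_line[OF _ k j] convergence) auto
      show "?a (k(j := m)) * (\<tau>\<^sub>0 j - T j y) = real m * ?t (k(j := m)) y" for m
        using shifted_term_mult[OF j, of f \<tau>\<^sub>0 y "k(j := m)"] by simp
    \<comment> \<open>At \<open>m = 0\<close> the numerator is zero; if the clock difference is
      zero, its power \<open>m - 1\<close> vanishes from \<open>m = 2\<close> on.\<close>
    qed (simp_all add: shifted_term_def)
    from has_sum_uminusI[OF this]
    show "((\<lambda>m. - (?a ((k(j := m))(j := Suc ((k(j := m)) j))) - ?a (k(j := m)))) has_sum 0) UNIV"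
      by simp
  qed
  \<comment> \<open>The bracket matrix times \<open>Ainv\<close> is inserted as the identity, to
    pass from the combinations in \<open>S_F\<close> back to a single constraint.\<close>
  have "pb ?F (C q) y = (\<Sum>l=1..n. (if q = l then 1 else 0) * pb ?F (C l) y)"
    using q by (simp add: if_distrib[of "\<lambda>z. z * _"] cong: if_cong)
  also have "\<dots> = (\<Sum>l=1..n. (\<Sum>j=1..n. pb (C q) (T j) y * Ainv j l y) * pb ?F (C l) y)"
    using A_invertible[of y] q unfolding inverse_matrix_def by (intro sum.cong refl) auto
  also have "\<dots> = (\<Sum>j=1..n. pb (C q) (T j) y * (\<Sum>l=1..n. Ainv j l y * pb ?F (C l) y))"
    unfolding sum_distrib_left sum_distrib_right by (subst sum.swap) (simp add: mult_ac)
  also have "\<dots> = 0"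
    by (intro sum.neutral ballI) (simp only: S_F mult_zero_right)
  finally show "pb ?F (C q) y = 0" .
qed

end
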